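(* Let $\tau>2$. For each $n$ let $\boldsymbol d=\boldsymbol d^{(n)}=(d_1,\dots,d_n)$ be a sequence of positive integers with even sum, and let $D_n$ be the degree of a uniformly chosen vertex. Suppose that there is a random variable $D$ such that $D_n$ converges in distribution to $D$ as $n\to\infty$ and $\mathbb E[D_n]\to\mathbb E[D]<\infty$. Suppose moreover that $\nu_n\to\infty$ with $\nu_n=\Theta(n^{2/(\tau-1)-1})$. Then, for the configuration model $\mathrm{CM}_n(\boldsymbol d)$, $$\frac{S_n-\nu_n/2}{\sqrt{\nu_n/2}}\ \xrightarrow{\ d\ }\ Z\qquad(n\to\infty),$$ where $Z$ is a standard normal random variable.
   Context: Configuration model: given positive integers $\boldsymbol d=(d_1,\dots,d_n)$ with even sum $\ell_n=\sum_{i\in[n]}d_i$, where $[n]=\{1,\dots,n\}$, attach $d_i$ half-edges to vertex $i$ for each $i\in[n]$, and match the $\ell_n$ half-edges in pairs uniformly at random; each pair forms an edge. The resulting random multigraph on $[n]$ is $\mathrm{CM}_n(\boldsymbol d)$. For $i\in[n]$, $X_{ii}$ is the number of self-loops at $i$. Define $$S_n=\sum_{i\in[n]}X_{ii},\qquad \nu_n=\frac{\sum_{i\in[n]}d_i(d_i-1)}{\ell_n}.$$ The random variable $D_n=d_V$ with $V$ uniform on $[n]$ has distribution function $F_n(x)=\frac1n\sum_{j\in[n]}\mathbf 1\{d_j\le x\}$. $f(n)=\Theta(g(n))$ means $f(n)=O(g(n))$ and $g(n)=O(f(n))$ as $n\to\infty$. $\xrightarrow{d}$ denotes convergence in distribution.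 *)

theory Defs
  imports "HOL-Probability.Probability" "HOL-Library.Landau_Symbols"
    "HOL-Library.Disjoint_Sets" "HOL-Library.Multiset"
begin

text \<open>The pair \<open>(i, k)\<close> is the \<open>k\<close>-th half-edge attached to vertex \<open>i\<close>. Only the values of the
  degree sequence \<open>d\<close> on \<open>{1..n}\<close> matter throughout.\<close>

definition half_edges :: "nat \<Rightarrow> (nat \<Rightarrow> nat) \<Rightarrow> (nat \<times> nat) set" where
  "half_edges n d = (SIGMA i:{1..n}. {1..d i})"

definition pairings :: "'h set \<Rightarrow> 'h set set set" where
  "pairings H = {P. partition_on H P \<and> (\<forall>e\<in>P. card e = 2)}"

text \<open>A multigraph is given by its multiset of edges, and an edge by the two-element multiset of its
  endpoints; thus \<open>{#i, i#}\<close> is a self-loop at \<open>i\<close>, and it is counted once although it uses two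
  half-edges.\<close>

definition multigraph_of_pairing :: "(nat \<times> nat) set set \<Rightarrow> nat multiset multiset" where
  "multigraph_of_pairing P = image_mset (\<lambda>e. image_mset fst (mset_set e)) (mset_set P)"

text \<open>\<open>pmf_of_set\<close> is the uniform distribution only on finite nonempty sets: the set of pairings is
  always finite, and it is nonempty exactly when the total degree is even.\<close>

definition configuration_model :: "nat \<Rightarrow> (nat \<Rightarrow> nat) \<Rightarrow> nat multiset multiset pmf" where
  "configuration_model n d =
     map_pmf multigraph_of_pairing (pmf_of_set (pairings (half_edges n d)))"

definition self_loops_at :: "nat multiset multiset \<Rightarrow> nat \<Rightarrow> nat" where
  "self_loops_at G i = count G {#i, i#}"

definition self_loops :: "nat \<Rightarrow> nat multiset multiset \<Rightarrow> nat" where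
  "self_loops n G = (\<Sum>i\<in>{1..n}. self_loops_at G i)"

definition total_degree :: "nat \<Rightarrow> (nat \<Rightarrow> nat) \<Rightarrow> nat" where
  "total_degree n d = (\<Sum>i\<in>{1..n}. d i)"

definition nu :: "nat \<Rightarrow> (nat \<Rightarrow> nat) \<Rightarrow> real" where
  "nu n d = (\<Sum>i\<in>{1..n}. real (d i) * (real (d i) - 1)) / real (total_degree n d)"

text \<open>The law of the degree of a uniformly chosen vertex, for \<open>n \<ge> 1\<close>.\<close>

definition degree_pmf :: "nat \<Rightarrow> (nat \<Rightarrow> nat) \<Rightarrow> nat pmf" where
  "degree_pmf n d = map_pmf d (pmf_of_set {1..n})"

end

theory Submission
  imports Defs "HOL-Combinatorics.Transposition"
begin

text \<open>
  Write \<open>\<mu> = \<nu>\<^sub>n / 2\<close>. The proof is a Stein--Chen argument for characteristic functions. If the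
  uniform pairing \<open>P\<close> matches \<open>a\<close> with \<open>x\<close>, then exchanging the half-edges \<open>x\<close> and \<open>b\<close> in \<open>P\<close> gives a
  uniform pairing among those containing \<open>{a, b}\<close>. This exchange affects only two edges, so the
  number \<open>S\<close> of self-loops typically grows by exactly one when \<open>{a, b}\<close> is a potential loop. Hence
  \<open>E (S g(S)) = \<mu> E (g(S + 1))\<close> up to an error governed by \<open>\<nu>\<^sub>n / \<ell>\<^sub>n\<close>. For \<open>g(s) = exp (i t s)\<close>
  this says that the characteristic function \<open>\<psi>\<close> of \<open>(S - \<mu>) / \<surd>\<mu>\<close> nearly solves
  \<open>\<psi>' (u) = - u \<psi> (u)\<close>, which forces \<open>\<psi> (u) \<rightarrow> exp (- u\<^sup>2 / 2)\<close>. The error vanishes because \<open>\<ell>\<^sub>n \<ge> n\<close> and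
  \<open>2 / (\<tau> - 1) - 1 < 1\<close> give \<open>\<nu>\<^sub>n / \<ell>\<^sub>n \<rightarrow> 0\<close>.
\<close>

section \<open>Pairings and switches\<close>

text \<open>The set \<open>E\<close> holds edges already revealed: the uniform law on this set is
  that of a uniform pairing conditioned on containing \<open>E\<close>.\<close>

definition pairings_over :: "'h set \<Rightarrow> 'h set set \<Rightarrow> 'h set set set" where
  "pairings_over H E = {P \<in> pairings H. E \<subseteq> P}"

lemma pairings_over_empty [simp]: "pairings_over H {} = pairings H"
  by (simp add: pairings_over_def)

lemma finite_pairings: "finite H \<Longrightarrow> finite (pairings H)"
  unfolding pairings_def using finitely_many_partition_on by (rule finite_subset[rotated]) auto

lemma finite_pairings_over: "finite H \<Longrightarrow> finite (pairings_over H E)"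
  by (simp add: pairings_over_def finite_pairings)

lemma finite_pairing: "P \<in> pairings H \<Longrightarrow> finite H \<Longrightarrow> finite P"
  unfolding pairings_def using finite_elements by auto

lemma pairing_disjoint: "P \<in> pairings H \<Longrightarrow> e \<in> P \<Longrightarrow> f \<in> P \<Longrightarrow> z \<in> e \<Longrightarrow> z \<in> f \<Longrightarrow> e = f"
  unfolding pairings_def partition_on_def disjoint_def by auto

lemma pairing_subset: "P \<in> pairings H \<Longrightarrow> e \<in> P \<Longrightarrow> e \<subseteq> H"
  unfolding pairings_def partition_on_def by auto

lemma pairing_edge:
  assumes "P \<in> pairings H" "e \<in> P"
  obtains a b where "e = {a, b}" "a \<noteq> b" "a \<in> H" "b \<in> H"
proof -
  have "card e = 2" using assms by (auto simp: pairings_def)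
  then obtain a b where "e = {a, b}" "a \<noteq> b" by (meson card_2_iff)
  with pairing_subset[OF assms] that show ?thesis by auto
qed

lemma pairing_partner:
  assumes "P \<in> pairings H" "a \<in> H"
  obtains x where "x \<in> H" "x \<noteq> a" "{a, x} \<in> P"
proof -
  obtain e where e: "e \<in> P" "a \<in> e"
    using assms unfolding pairings_def partition_on_def by auto
  from pairing_edge[OF assms(1) e(1)] obtain u v where "e = {u, v}" "u \<noteq> v" "u \<in> H" "v \<in> H" .
  with e that[of v] that[of u] show ?thesis by (auto simp: insert_commute)
qed

text \<open>Removing two points from a nonempty even set leaves a smaller even set, so a pairing can
  be built edge by edge. Nonemptiness makes \<open>pmf_of_set\<close> a genuine uniform law.\<close>

lemma pairings_nonempty:
  assumes "finite H" "even (card H)"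
  shows "pairings H \<noteq> {}"
  using assms
proof (induction "card H" arbitrary: H rule: less_induct)
  case less
  show ?case
  proof (cases "H = {}")
    case True
    then show ?thesis by (auto simp: pairings_def partition_on_empty)
  next
    case False
    then obtain a where a: "a \<in> H" by auto
    have "H \<noteq> {a}" using less.prems by auto
    then obtain b where b: "b \<in> H" "b \<noteq> a" using a by blast
    have c: "card {a, b} = 2" using b by simp
    have sub: "{a, b} \<subseteq> H" using a b by simp
    then have "card (H - {a, b}) = card H - 2" "2 \<le> card H"
      using c card_Diff_subset[OF _ sub] card_mono[OF less.prems(1) sub] by simp_all
    then have "pairings (H - {a, b}) \<noteq> {}"
      using less.prems by (intro less.hyps) auto
    then obtain P where P: "P \<in> pairings (H - {a, b})" by auto
    then have "disjnt {a, b} (\<Union>P)" unfolding pairings_def partition_on_def disjnt_def by auto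
    then have "insert {a, b} P \<in> pairings H"
      using P c sub unfolding pairings_def mem_Collect_eq by (subst partition_on_insert) auto
    then show ?thesis by auto
  qed
qed

lemma pairings_image:
  assumes "P \<in> pairings H" "bij_betw \<pi> H H"
  shows "(`) \<pi> ` P \<in> pairings H"
proof -
  have inj: "inj_on \<pi> H" and im: "\<pi> ` H = H" using assms by (auto simp: bij_betw_def)
  have "card (\<pi> ` e) = 2" if "e \<in> P" for e
    using card_image[OF inj_on_subset[OF inj pairing_subset[OF assms(1) that]]] assms(1) that
    by (simp add: pairings_def)
  moreover have "(`) \<pi> ` P - {{}} = (`) \<pi> ` P"
    using assms(1) by (auto simp: pairings_def partition_on_def)
  ultimately show ?thesis
    using partition_on_inj_image[OF _ inj, of P] assms im by (auto simp: pairings_def)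
qed

text \<open>The transposition of \<open>x\<close> and \<open>b\<close> fixes \<open>a\<close> and
  every half-edge used by \<open>E\<close>, so it carries \<open>{a, x}\<close> to
  \<open>{a, b}\<close> and preserves \<open>E\<close>. Being an involution, it supplies its own
  inverse. The case \<open>x = b\<close> is allowed and gives the identity.\<close>

lemma bij_betw_switch:
  assumes "x \<in> H" "b \<in> H" "x \<notin> \<Union>E" "b \<notin> \<Union>E" "a \<noteq> x" "a \<noteq> b"
  shows "bij_betw ((`) ((`) (Transposition.transpose x b)))
    (pairings_over H (insert {a, x} E)) (pairings_over H (insert {a, b} E))"
proof -
  have inv: "(`) ((`) (Transposition.transpose x b)) ((`) ((`) (Transposition.transpose x b)) P) = P" for P :: "'a set set"
    by (simp add: image_image)
  have fixE: "Transposition.transpose x b ` e = e" if "e \<in> E" for e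
    using that assms by (intro transpose_image_eq) auto
  have mem: "((`) (Transposition.transpose x b)) ` P \<in> pairings H" if "P \<in> pairings H" for P
    using that assms by (intro pairings_image) auto
  have over: "((`) (Transposition.transpose x b)) ` P \<in> pairings_over H (insert {a, Transposition.transpose x b v} E)"
    if "P \<in> pairings_over H (insert {a, v} E)" for P v
  proof -
    have "Transposition.transpose x b ` {a, v} \<in> (`) (Transposition.transpose x b) ` P"
      using that unfolding pairings_over_def by blast
    moreover have "Transposition.transpose x b ` {a, v} = {a, Transposition.transpose x b v}"
      using assms by auto
    moreover have "E \<subseteq> (`) (Transposition.transpose x b) ` P"
    proof
      fix e assume "e \<in> E"
      then have "e \<in> P" "Transposition.transpose x b ` e = e" using that fixE by (auto simp: pairings_over_def)
      then show "e \<in> (`) (Transposition.transpose x b) ` P" by (metis imageI)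
    qed
    ultimately show ?thesis using that mem by (auto simp: pairings_over_def)
  qed
  show ?thesis
    by (rule bij_betw_byWitness[where f' = "(`) ((`) (Transposition.transpose x b))"])
      (use inv over[where v = x] over[where v = b] in auto)
qed

section \<open>Counting through the partner of a half-edge\<close>

text \<open>Each pairing has exactly one edge at \<open>a\<close>; this is conditioning on the other
  end of that edge.\<close>

lemma sum_pairings_over:
  fixes F :: "_ \<Rightarrow> 'c :: comm_monoid_add"
  assumes "finite H" "a \<in> H" "a \<notin> \<Union>E"
  shows "sum F (pairings_over H E) =
    (\<Sum>x\<in>H - {a} - \<Union>E. sum F (pairings_over H (insert {a, x} E)))"
proof -
  have "pairings_over H E = (\<Union>x\<in>H - {a} - \<Union>E. pairings_over H (insert {a, x} E))"
  proof (intro equalityI subsetI)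
    fix P assume P: "P \<in> pairings_over H E"
    then have Pp: "P \<in> pairings H" and EP: "E \<subseteq> P" by (auto simp: pairings_over_def)
    obtain x where x: "x \<in> H" "x \<noteq> a" "{a, x} \<in> P" using pairing_partner[OF Pp assms(2)] .
    \<comment> \<open>Otherwise the edge of \<open>E\<close> through \<open>x\<close> would be
      \<open>{a, x}\<close> itself, which would put \<open>a\<close> into
      \<Union>\<open>E\<close>.\<close>
    have "x \<notin> \<Union>E"
      using pairing_disjoint[OF Pp x(3), of _ x] EP assms(3) by blast
    then show "P \<in> (\<Union>x\<in>H - {a} - \<Union>E. pairings_over H (insert {a, x} E))"
      using x P by (auto simp: pairings_over_def)
  qed (auto simp: pairings_over_def)
  also have "sum F \<dots> = (\<Sum>x\<in>H - {a} - \<Union>E. sum F (pairings_over H (insert {a, x} E)))"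
  proof (rule sum.UNION_disjoint)
    show "\<forall>x\<in>H - {a} - \<Union>E. \<forall>y\<in>H - {a} - \<Union>E. x \<noteq> y \<longrightarrow>
      pairings_over H (insert {a, x} E) \<inter> pairings_over H (insert {a, y} E) = {}"
    proof (intro ballI impI, rule ccontr)
      fix x y
      assume xy: "x \<in> H - {a} - \<Union>E" "y \<in> H - {a} - \<Union>E" "x \<noteq> y"
        and "pairings_over H (insert {a, x} E) \<inter> pairings_over H (insert {a, y} E) \<noteq> {}"
      then obtain P where P: "P \<in> pairings H" "{a, x} \<in> P" "{a, y} \<in> P"
        by (auto simp: pairings_over_def)
      have "{a, x} = {a, y}" by (rule pairing_disjoint[OF P, of a]) auto
      then show False using xy by (auto simp: doubleton_eq_iff)
    qed
  qed (use assms finite_pairings_over in auto)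
  finally show ?thesis .
qed

text \<open>By the switch, all half-edges still available to \<open>a\<close> are equally likely
  partners: a uniform pairing can be revealed one edge at a time.\<close>

lemma card_pairings_over_insert:
  assumes "finite H" "a \<in> H" "a \<notin> \<Union>E" "b \<in> H - {a} - \<Union>E"
  shows "card (pairings_over H E) =
    card (H - {a} - \<Union>E) * card (pairings_over H (insert {a, b} E))"
proof -
  have "card (pairings_over H (insert {a, x} E)) = card (pairings_over H (insert {a, b} E))"
    if "x \<in> H - {a} - \<Union>E" for x
    using that assms by (intro bij_betw_same_card[OF bij_betw_switch]) auto
  then show ?thesis
    using sum_pairings_over[OF assms(1-3), of "\<lambda>_. 1 :: nat"] by simp
qed

section \<open>Monochromatic edges under a switch\<close>

text \<open>With half-edges coloured by their vertex, the monochromatic edges are the self-loops.\<close>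

definition monochromatic :: "('h \<Rightarrow> 'v) \<Rightarrow> 'h set set \<Rightarrow> nat" where
  "monochromatic c P = card {e \<in> P. is_singleton (c ` e)}"

text \<open>Potential loops are taken as ordered pairs, because a switch treats its ends
  \<open>a\<close> and \<open>b\<close> differently. Each loop then appears twice, and for
  half-edges the cardinality is the numerator of \<nu>.\<close>

definition mono_pairs :: "('h \<Rightarrow> 'v) \<Rightarrow> 'h set \<Rightarrow> ('h \<times> 'h) set" where
  "mono_pairs c H = {(a, b). a \<in> H \<and> b \<in> H \<and> a \<noteq> b \<and> c a = c b}"

lemma finite_mono_pairs: "finite H \<Longrightarrow> finite (mono_pairs c H)"
  by (rule finite_subset[of _ "H \<times> H"]) (auto simp: mono_pairs_def)

lemma is_singleton_image_doubleton [simp]: "is_singleton (c ` {a, b}) \<longleftrightarrow> c a = c b"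
  by (auto simp: is_singleton_def doubleton_eq_iff)

lemma real_monochromatic:
  "finite P \<Longrightarrow> real (monochromatic c P) = (\<Sum>e\<in>P. of_bool (is_singleton (c ` e)))"
  by (simp add: monochromatic_def Int_def)

text \<open>An edge \<open>{u, v}\<close> arises from exactly the two ordered pairs
  \<open>(u, v)\<close> and \<open>(v, u)\<close>.\<close>

lemma card_mono_pairs_in_pairing:
  assumes "finite H" "P \<in> pairings H"
  shows "card {(a, b) \<in> mono_pairs c H. {a, b} \<in> P} = 2 * monochromatic c P"
proof -
  let ?M = "{e \<in> P. is_singleton (c ` e)}"
  have fin: "finite ?M" using finite_pairing[OF assms(2,1)] by simp
  have "{(a, b) \<in> mono_pairs c H. {a, b} \<in> P} = (\<Union>e\<in>?M. {(a, b). a \<noteq> b \<and> e = {a, b}})"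
    using pairing_subset[OF assms(2)] unfolding mono_pairs_def
    by (auto simp del: image_insert)
  moreover have "card {(a, b). a \<noteq> b \<and> e = {a, b}} = 2 \<and> finite {(a, b). a \<noteq> b \<and> e = {a, b}}"
    if e: "e \<in> ?M" for e
  proof -
    obtain u v where uv: "e = {u, v}" "u \<noteq> v" using pairing_edge[OF assms(2)] e by blast
    then have "{(a, b). a \<noteq> b \<and> e = {a, b}} = {(u, v), (v, u)}"
      by (auto simp: doubleton_eq_iff)
    then show ?thesis using uv by simp
  qed
  moreover have "card (\<Union>e\<in>?M. {(a, b). a \<noteq> b \<and> e = {a, b}}) =
      (\<Sum>e\<in>?M. card {(a, b). a \<noteq> b \<and> e = {a, b}})"
    using calculation(2) by (intro card_UN_disjoint fin) auto
  ultimately show ?thesis by (simp add: monochromatic_def)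
qed

text \<open>The switch replaces \<open>{a, x}\<close> and \<open>{b, y}\<close> by
  \<open>{a, b}\<close> and \<open>{x, y}\<close> and keeps all other edges. Distinctness of the
  four half-edges ensures that two different edges are removed and two different ones added.\<close>

lemma monochromatic_switch:
  assumes H: "finite H" and P: "P \<in> pairings H" "{a, x} \<in> P" "{b, y} \<in> P"
    and dist: "a \<noteq> x" "a \<noteq> b" "a \<noteq> y" "x \<noteq> b" "x \<noteq> y" "b \<noteq> y"
  shows "real (monochromatic c ((`) (Transposition.transpose x b) ` P)) =
    real (monochromatic c P) + of_bool (c a = c b) + of_bool (c x = c y)
      - of_bool (c a = c x) - of_bool (c b = c y)"
proof -
  define R where "R = P - {{a, x}, {b, y}}"
  have finR: "finite R" using finite_pairing[OF P(1) H] by (simp add: R_def)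
  have PR: "P = insert {a, x} (insert {b, y} R)" using P by (auto simp: R_def)
  have ne: "{a, x} \<noteq> {b, y}" "{a, b} \<noteq> {x, y}" using dist by (auto simp: doubleton_eq_iff)
  \<comment> \<open>The edges of a pairing are disjoint, so none of the remaining ones can meet the
    two removed edges.\<close>
  have R: "z \<notin> e" if "e \<in> R" "z \<in> {a, x, b, y}" for e z
  proof
    assume "z \<in> e"
    with that have "e = {a, x} \<or> e = {b, y}"
      using pairing_disjoint[OF P(1) _ P(2), of e z] pairing_disjoint[OF P(1) _ P(3), of e z]
      by (auto simp: R_def)
    with that show False by (auto simp: R_def)
  qed
  have "Transposition.transpose x b ` e = e" if "e \<in> R" for e
    using R[OF that] by (intro transpose_image_eq) auto
  then have "(`) (Transposition.transpose x b) ` R = R" by simp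
  moreover have "Transposition.transpose x b ` {a, x} = {a, b}" "Transposition.transpose x b ` {b, y} = {x, y}"
    using dist by auto
  ultimately have swP: "(`) (Transposition.transpose x b) ` P = insert {a, b} (insert {x, y} R)"
    unfolding PR by (simp only: image_insert)
  have "{a, x} \<notin> R" "{b, y} \<notin> R" "{a, b} \<notin> R" "{x, y} \<notin> R" using R by blast+
  then show ?thesis
    unfolding swP using finR ne
    by (simp add: PR real_monochromatic del: image_insert)
qed

section \<open>Average error of a switch and the Stein identity\<close>

text \<open>The outer sum runs over all pairings, sorted by the partner \<open>x\<close> of
  \<open>a\<close>. Let \<open>y\<close> be the partner of \<open>b\<close>. As
  \<open>c a = c b\<close>, the increment deviates from 1 only if \<open>x = b\<close> or one of
  \<open>c a = c x\<close>, \<open>c b = c y\<close>, \<open>c x = c y\<close> holds. Revealing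
  \<open>x\<close> and then \<open>y\<close> gives these cases shares of at most
  \<open>1 / (l - 1)\<close>, \<open>K / (l - 1)\<close>, \<open>l * K / ((l - 1) * (l - 3))\<close>
  and \<open>card (mono_pairs c H) / ((l - 1) * (l - 3))\<close>.\<close>

lemma sum_switch_error_le:
  fixes K :: real
  assumes H: "finite H" "card H \<ge> 4" and ab: "(a, b) \<in> mono_pairs c H"
    and K: "\<And>h. h \<in> H \<Longrightarrow> real (card {x \<in> H - {h}. c x = c h}) \<le> K"
  defines "l \<equiv> real (card H)"
  shows "(\<Sum>x\<in>H - {a}. \<Sum>P\<in>pairings_over H {{a, x}}.
      \<bar>real (monochromatic c ((`) (Transposition.transpose x b) ` P)) - real (monochromatic c P) - 1\<bar>)
    \<le> real (card (pairings H)) *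
      ((1 + K) / (l - 1) + (l * K + real (card (mono_pairs c H))) / ((l - 1) * (l - 3)))"
proof -
  \<comment> \<open>\<open>q1\<close> and \<open>q2\<close> are the numbers of pairings containing
    one, respectively two disjoint, prescribed edges.\<close>
  define q1 where "q1 = real (card (pairings H)) / (l - 1)"
  define q2 where "q2 = q1 / (l - 3)"
  define err where "err x P = \<bar>real (monochromatic c ((`) (Transposition.transpose x b) ` P))
    - real (monochromatic c P) - 1\<bar>" for x P
  define L where "L x y = (of_bool (c x = c y) :: real)" for x y
  have a: "a \<in> H" and b: "b \<in> H" and "a \<noteq> b" and cab: "c a = c b"
    using ab by (auto simp: mono_pairs_def)
  have l4: "l \<ge> 4" using H by (simp add: l_def)
  have q1_0: "q1 \<ge> 0" and q2_0: "q2 \<ge> 0" using l4 by (simp_all add: q1_def q2_def)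
  have card1: "real (card (H - {a})) = l - 1"
    using a H by (simp add: l_def of_nat_diff)
  have card_over1: "real (card (pairings_over H {{a, x}})) = q1" if "x \<in> H - {a}" for x
  proof -
    have "card (pairings H) = card (H - {a}) * card (pairings_over H {{a, x}})"
      using card_pairings_over_insert[of H a "{}" x] a that H by simp
    then have "real (card (pairings H)) = (l - 1) * real (card (pairings_over H {{a, x}}))"
      unfolding card1[symmetric] by simp
    then show ?thesis using l4 by (simp add: q1_def)
  qed
  have card3: "real (card (H - {b} - {a, x})) = l - 3" if "x \<in> H - {a} - {b}" for x
  proof -
    have "H - {b} - {a, x} = H - {a, b, x}" by auto
    moreover have "card (H - {a, b, x}) = card H - 3"
      using that a b \<open>a \<noteq> b\<close> H by (subst card_Diff_subset) auto
    ultimately show ?thesis using H by (simp add: l_def of_nat_diff)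
  qed
  have card_over2: "real (card (pairings_over H {{b, y}, {a, x}})) = q2"
    if x: "x \<in> H - {a} - {b}" and y: "y \<in> H - {b} - {a, x}" for x y
  proof -
    have "card (pairings_over H {{a, x}}) =
        card (H - {b} - {a, x}) * card (pairings_over H {{b, y}, {a, x}})"
      using card_pairings_over_insert[of H b "{{a, x}}" y] a b \<open>a \<noteq> b\<close> x y H by auto
    then have "q1 = (l - 3) * real (card (pairings_over H {{b, y}, {a, x}}))"
      unfolding card3[OF x, symmetric] using card_over1[of x] x by simp
    then show ?thesis using l4 by (simp add: q2_def)
  qed
  have deg: "(\<Sum>y\<in>A. L h y) \<le> K" if "A \<subseteq> H - {h}" "h \<in> H" for A h
  proof -
    have "(\<Sum>y\<in>A. L h y) \<le> (\<Sum>y\<in>H - {h}. L h y)"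
      using that H by (intro sum_mono2) (auto simp: L_def)
    also have "\<dots> = real (card {x \<in> H - {h}. c x = c h})"
      using H by (simp add: L_def Int_def conj_commute eq_commute)
    finally show ?thesis using K[OF that(2)] by simp
  qed
  \<comment> \<open>For \<open>x = b\<close> the switch is the identity, so the expected gain of one
    loop is missed entirely.\<close>
  have err_b: "err b P = 1" for P by (simp add: err_def)
  have err_le: "err x P \<le> L a x + L b y + L x y"
    if x: "x \<in> H - {a} - {b}" and y: "y \<in> H - {b} - {a, x}"
      and P: "P \<in> pairings_over H {{b, y}, {a, x}}" for x y P
  proof -
    have "real (monochromatic c ((`) (Transposition.transpose x b) ` P)) =
      real (monochromatic c P) + L a b + L x y - L a x - L b y"
      unfolding L_def using P x y \<open>a \<noteq> b\<close>
      by (intro monochromatic_switch[OF H(1)]) (auto simp: pairings_over_def)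
    moreover have "L a b = 1" "L a x \<ge> 0" "L b y \<ge> 0" "L x y \<ge> 0" using cab by (simp_all add: L_def)
    ultimately show ?thesis by (simp add: err_def)
  qed
  have inner: "(\<Sum>P\<in>pairings_over H {{a, x}}. err x P)
      \<le> q1 * L a x + q2 * K + q2 * (\<Sum>y\<in>H - {b} - {a, x}. L x y)"
    if x: "x \<in> H - {a} - {b}" for x
  proof -
    have "(\<Sum>P\<in>pairings_over H {{a, x}}. err x P) =
        (\<Sum>y\<in>H - {b} - {a, x}. \<Sum>P\<in>pairings_over H {{b, y}, {a, x}}. err x P)"
      using sum_pairings_over[of H b "{{a, x}}" "err x"] H b x \<open>a \<noteq> b\<close> by auto
    also have "\<dots> \<le> (\<Sum>y\<in>H - {b} - {a, x}.
        \<Sum>P\<in>pairings_over H {{b, y}, {a, x}}. L a x + L b y + L x y)"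
      using err_le x by (intro sum_mono) auto
    also have "\<dots> = (\<Sum>y\<in>H - {b} - {a, x}. q2 * (L a x + L b y + L x y))"
      using card_over2[OF x] by (intro sum.cong refl) simp
    also have "\<dots> = q2 * (real (card (H - {b} - {a, x})) * L a x
        + (\<Sum>y\<in>H - {b} - {a, x}. L b y) + (\<Sum>y\<in>H - {b} - {a, x}. L x y))"
      by (simp add: sum_distrib_left[symmetric] sum.distrib)
    also have "\<dots> \<le> q2 * ((l - 3) * L a x + K + (\<Sum>y\<in>H - {b} - {a, x}. L x y))"
      using card3[OF x] deg[of "H - {b} - {a, x}" b] b q2_0 by (intro mult_left_mono) auto
    also have "\<dots> = q1 * L a x + q2 * K + q2 * (\<Sum>y\<in>H - {b} - {a, x}. L x y)"
    proof -
      have "q1 = q2 * (l - 3)" using l4 by (simp add: q2_def)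
      then show ?thesis by (simp only:) (simp add: algebra_simps)
    qed
    finally show ?thesis .
  qed
  have "(\<Sum>x\<in>H - {a} - {b}. \<Sum>y\<in>H - {b} - {a, x}. L x y)
      = (\<Sum>(x, y)\<in>(SIGMA x:H - {a} - {b}. H - {b} - {a, x}). L x y)"
    using H by (simp add: sum.Sigma)
  also have "\<dots> = real (card {(x, y) \<in> (SIGMA x:H - {a} - {b}. H - {b} - {a, x}). c x = c y})"
    using H by (simp add: L_def case_prod_unfold Int_def) (rule arg_cong[where f = card], auto)
  also have "\<dots> \<le> real (card (mono_pairs c H))"
    using finite_mono_pairs[OF H(1)]
    by (intro of_nat_mono card_mono) (auto simp: mono_pairs_def)
  finally have M: "(\<Sum>x\<in>H - {a} - {b}. \<Sum>y\<in>H - {b} - {a, x}. L x y) \<le> real (card (mono_pairs c H))" .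
  have K0: "K \<ge> 0" using K[OF a] by linarith
  have cle: "real (card (H - {a} - {b})) \<le> l"
    unfolding l_def using H by (intro of_nat_mono card_mono) auto
  have "(\<Sum>x\<in>H - {a}. \<Sum>P\<in>pairings_over H {{a, x}}. err x P) =
      (\<Sum>P\<in>pairings_over H {{a, b}}. err b P)
      + (\<Sum>x\<in>H - {a} - {b}. \<Sum>P\<in>pairings_over H {{a, x}}. err x P)"
    using H b \<open>a \<noteq> b\<close> by (intro sum.remove) auto
  also have "(\<Sum>P\<in>pairings_over H {{a, b}}. err b P) = q1"
    using card_over1[of b] b \<open>a \<noteq> b\<close> by (simp add: err_b)
  also have "(\<Sum>x\<in>H - {a} - {b}. \<Sum>P\<in>pairings_over H {{a, x}}. err x P) \<le>
      (\<Sum>x\<in>H - {a} - {b}. q1 * L a x + q2 * K + q2 * (\<Sum>y\<in>H - {b} - {a, x}. L x y))"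
    by (intro sum_mono inner)
  also have "\<dots> = q1 * (\<Sum>x\<in>H - {a} - {b}. L a x) + real (card (H - {a} - {b})) * (q2 * K)
      + q2 * (\<Sum>x\<in>H - {a} - {b}. \<Sum>y\<in>H - {b} - {a, x}. L x y)"
    by (simp add: sum.distrib sum_distrib_left[symmetric] mult.left_commute)
  also have "\<dots> \<le> q1 * K + l * (q2 * K) + q2 * real (card (mono_pairs c H))"
    using deg[of "H - {a} - {b}" a] a q1_0 q2_0 K0 M cle
    by (intro add_mono mult_left_mono mult_right_mono) auto
  also have "q1 + (q1 * K + l * (q2 * K) + q2 * real (card (mono_pairs c H))) =
      real (card (pairings H)) *
      ((1 + K) / (l - 1) + (l * K + real (card (mono_pairs c H))) / ((l - 1) * (l - 3)))"
    by (simp add: q1_def q2_def add_divide_distrib algebra_simps)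
  finally show ?thesis by (simp add: err_def)
qed

text \<open>Sum over potential loops \<open>(a, b)\<close>: pairings containing
  \<open>{a, b}\<close> are switched copies of arbitrary pairings, in which the count is nearly one
  larger. The Lipschitz constant \<open>B\<close> converts the error in the count into one in
  \<open>g\<close>. Taking \<open>g\<close> constantly 1 and \<open>B = 0\<close> shows that
  \<open>M / (2 * (l - 1))\<close> is the exact mean of the count.\<close>

lemma stein_monochromatic:
  fixes K B :: real and g :: "nat \<Rightarrow> complex"
  assumes H: "finite H" "card H \<ge> 4"
    and K: "\<And>h. h \<in> H \<Longrightarrow> real (card {x \<in> H - {h}. c x = c h}) \<le> K"
    and g: "\<And>m m'. norm (g m - g m') \<le> B * \<bar>real m - real m'\<bar>"
  defines "l \<equiv> real (card H)" and "M \<equiv> real (card (mono_pairs c H))"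
  shows "norm ((\<Sum>P\<in>pairings H. of_nat (monochromatic c P) * g (monochromatic c P))
      - of_real (M / (2 * (l - 1))) * (\<Sum>P\<in>pairings H. g (Suc (monochromatic c P))))
    \<le> M / (2 * (l - 1)) * B * real (card (pairings H)) *
      ((1 + K) / (l - 1) + (l * K + M) / ((l - 1) * (l - 3)))"
proof -
  let ?S = "monochromatic c"
  define N where "N = real (card (pairings H))"
  define \<epsilon> where "\<epsilon> = (1 + K) / (l - 1) + (l * K + M) / ((l - 1) * (l - 3))"
  define G where "G = (\<Sum>P\<in>pairings H. g (Suc (?S P)))"
  define T where "T a b = (\<Sum>P\<in>pairings_over H {{a, b}}. g (?S P))" for a b
  have l4: "l \<ge> 4" using H by (simp add: l_def)
  have B0: "B \<ge> 0" using order_trans[OF norm_ge_zero g[of 0 1]] by simp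
  \<comment> \<open>Each of the \<open>l - 1\<close> possible partners \<open>x\<close> of
    \<open>a\<close> yields one copy of \<open>T a b\<close> by a switch, and together these
    partners exhaust all pairings.\<close>
  have T: "norm (of_real (l - 1) * T a b - G) \<le> B * (N * \<epsilon>)" if ab: "(a, b) \<in> mono_pairs c H" for a b
  proof -
    have a: "a \<in> H" and b: "b \<in> H" and "a \<noteq> b" using ab by (auto simp: mono_pairs_def)
    let ?sw = "\<lambda>x. (`) ((`) (Transposition.transpose x b)) :: 'a set set \<Rightarrow> 'a set set"
    have "(\<Sum>P\<in>pairings_over H {{a, x}}. g (?S (?sw x P))) = T a b" if "x \<in> H - {a}" for x
      unfolding T_def using that b \<open>a \<noteq> b\<close>
      by (intro sum.reindex_bij_betw bij_betw_switch) auto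
    then have "(\<Sum>x\<in>H - {a}. \<Sum>P\<in>pairings_over H {{a, x}}. g (?S (?sw x P))) =
        of_nat (card (H - {a})) * T a b"
      by simp
    also have "of_nat (card (H - {a})) = (of_real (l - 1) :: complex)"
      using a H by (simp add: l_def of_nat_diff)
    finally have "of_real (l - 1) * T a b - G =
        (\<Sum>x\<in>H - {a}. \<Sum>P\<in>pairings_over H {{a, x}}. g (?S (?sw x P)) - g (Suc (?S P)))"
      using sum_pairings_over[of H a "{}" "\<lambda>P. g (Suc (?S P))"] a H
      by (simp add: G_def sum_subtractf)
    also have "norm \<dots> \<le> (\<Sum>x\<in>H - {a}. \<Sum>P\<in>pairings_over H {{a, x}}.
        norm (g (?S (?sw x P)) - g (Suc (?S P))))"
      by (intro order_trans[OF norm_sum] sum_mono norm_sum)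
    also have "\<dots> \<le> (\<Sum>x\<in>H - {a}. \<Sum>P\<in>pairings_over H {{a, x}}.
        B * \<bar>real (?S (?sw x P)) - real (?S P) - 1\<bar>)"
      by (intro sum_mono order_trans[OF g]) (simp add: algebra_simps)
    also have "\<dots> = B * (\<Sum>x\<in>H - {a}. \<Sum>P\<in>pairings_over H {{a, x}}.
        \<bar>real (?S (?sw x P)) - real (?S P) - 1\<bar>)"
      by (simp add: sum_distrib_left)
    also have "\<dots> \<le> B * (N * \<epsilon>)"
      unfolding N_def \<epsilon>_def l_def M_def
      by (intro mult_left_mono B0 sum_switch_error_le H ab K)
    finally show ?thesis .
  qed
  \<comment> \<open>Double counting: a pairing contributes its value of \<open>g\<close> once for
    every ordered version of each of its monochromatic edges.\<close>
  have "(\<Sum>(a, b)\<in>mono_pairs c H. T a b) =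
      (\<Sum>p\<in>mono_pairs c H. \<Sum>P\<in>pairings H. if {fst p, snd p} \<in> P then g (?S P) else 0)"
    unfolding T_def pairings_over_def case_prod_unfold
    using finite_pairings[OF H(1)]
    by (intro sum.cong[OF refl, of "mono_pairs c H"]) (simp add: sum.inter_filter[symmetric])
  also have "\<dots> = (\<Sum>P\<in>pairings H. \<Sum>p\<in>mono_pairs c H. if {fst p, snd p} \<in> P then g (?S P) else 0)"
    by (rule sum.swap)
  also have "\<dots> = (\<Sum>P\<in>pairings H. 2 * (of_nat (?S P) * g (?S P)))"
  proof (intro sum.cong refl)
    fix P assume "P \<in> pairings H"
    from card_mono_pairs_in_pairing[OF H(1) this, of c]
    have "card {p \<in> mono_pairs c H. {fst p, snd p} \<in> P} = 2 * ?S P"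
      by (simp add: case_prod_unfold)
    then show "(\<Sum>p\<in>mono_pairs c H. if {fst p, snd p} \<in> P then g (?S P) else 0) =
        2 * (of_nat (?S P) * g (?S P))"
      using finite_mono_pairs[OF H(1), of c] by (simp add: sum.inter_filter[symmetric])
  qed
  finally have sumT: "2 * (\<Sum>P\<in>pairings H. of_nat (?S P) * g (?S P)) =
      (\<Sum>(a, b)\<in>mono_pairs c H. T a b)"
    by (simp add: sum_distrib_left)
  have "norm (\<Sum>(a, b)\<in>mono_pairs c H. of_real (l - 1) * T a b - G)
      \<le> (\<Sum>(a, b)\<in>mono_pairs c H. B * (N * \<epsilon>))"
    by (intro sum_norm_le) (use T in auto)
  also have "\<dots> = M * (B * (N * \<epsilon>))" by (simp add: M_def)
  also have "(\<Sum>(a, b)\<in>mono_pairs c H. of_real (l - 1) * T a b - G) =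
      of_real (l - 1) * (\<Sum>(a, b)\<in>mono_pairs c H. T a b) - of_real M * G"
    by (simp add: case_prod_unfold sum_subtractf sum_distrib_left M_def)
  also have "\<dots> = of_real (2 * (l - 1)) * ((\<Sum>P\<in>pairings H. of_nat (?S P) * g (?S P))
      - of_real (M / (2 * (l - 1))) * G)"
  proof -
    define z where "z = complex_of_real (l - 1)"
    have "z \<noteq> 0" using l4 unfolding z_def of_real_eq_0_iff by simp
    moreover have "of_real (M / (2 * (l - 1))) = of_real M / (2 * z)" "of_real (2 * (l - 1)) = 2 * z"
      by (simp_all add: z_def)
    ultimately show ?thesis
      unfolding sumT[symmetric] z_def[symmetric] by (simp add: field_simps)
  qed
  also have "norm \<dots> = 2 * (l - 1) * norm ((\<Sum>P\<in>pairings H. of_nat (?S P) * g (?S P))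
      - of_real (M / (2 * (l - 1))) * G)"
    using l4 by (simp only: norm_mult norm_of_real) simp
  finally have "norm ((\<Sum>P\<in>pairings H. of_nat (?S P) * g (?S P))
      - of_real (M / (2 * (l - 1))) * G) \<le> M * (B * (N * \<epsilon>)) / (2 * (l - 1))"
    using l4 by (subst pos_le_divide_eq) (simp_all add: mult.commute)
  then show ?thesis
    unfolding G_def[symmetric] N_def[symmetric] \<epsilon>_def[symmetric] by (simp add: mult_ac)
qed

section \<open>From the Stein identity to the characteristic function\<close>

lemma norm_iexp_diff_le: "cmod (iexp x - iexp y) \<le> \<bar>x - y\<bar>"
proof -
  have "iexp x - iexp y = iexp y * (iexp (x - y) - 1)"
    by (simp add: algebra_simps exp_add[symmetric])
  then have "cmod (iexp x - iexp y) = cmod (iexp (x - y) - 1)"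
    by (simp add: norm_mult)
  also have "\<dots> \<le> \<bar>x - y\<bar>" using iexp_approx1[of "x - y" 0] by simp
  finally show ?thesis .
qed

text \<open>The hypothesis covers all \<open>v\<close> between 0 and \<open>u\<close> because it
  bounds \<psi>\<open>' v + v\<close>\<psi>\<open>v\<close>, and this approximate differential
  equation is then integrated from 0 to \<open>u\<close>. The term \<open>u^2 / 2\<close> is a
  second-order Taylor remainder.\<close>

lemma norm_char_diff_le_of_stein:
  fixes S :: "'b \<Rightarrow> nat" and \<mu> \<eta> u :: real
  assumes A: "finite A" "A \<noteq> {}" and \<mu>: "\<mu> > 0"
    and stein: "\<And>v. \<bar>v\<bar> \<le> \<bar>u\<bar> \<Longrightarrow>
      cmod ((\<Sum>x\<in>A. of_nat (S x) * iexp (v / sqrt \<mu> * real (S x)))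
        - of_real \<mu> * (\<Sum>x\<in>A. iexp (v / sqrt \<mu> * real (Suc (S x))))) \<le> real (card A) * \<eta>"
  shows "cmod ((\<Sum>x\<in>A. iexp (u * ((real (S x) - \<mu>) / sqrt \<mu>))) / of_nat (card A)
      - of_real (exp (- (u\<^sup>2) / 2))) \<le> \<bar>u\<bar> * ((\<eta> + u\<^sup>2 / 2) / sqrt \<mu>)"
proof -
  define s where "s = sqrt \<mu>"
  have s: "s > 0" "s * s = \<mu>" using \<mu> by (simp_all add: s_def)
  define X where "X x = (real (S x) - \<mu>) / s" for x
  define N where "N = real (card A)"
  have N: "N > 0" using A by (simp add: N_def card_gt_0_iff)
  define \<psi> where "\<psi> v = (\<Sum>x\<in>A. iexp (v * X x)) / of_real N" for v
  define \<psi>' where "\<psi>' v = (\<Sum>x\<in>A. \<i> * of_real (X x) * iexp (v * X x)) / of_real N" for v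
  define E where "E = (\<eta> + u\<^sup>2 / 2) / s"
  have deriv: "(\<psi> has_vector_derivative \<psi>' v) (at v within T)" for v T
    unfolding \<psi>_def \<psi>'_def
  proof (intro bounded_linear.has_vector_derivative[OF bounded_linear_divide] has_vector_derivative_sum)
    fix x
    have "((\<lambda>z. exp (\<i> * (z * of_real (X x)))) has_field_derivative
        \<i> * of_real (X x) * iexp (v * X x)) (at (of_real v))"
      by (auto intro!: derivative_eq_intros)
    from has_vector_derivative_real_field[OF this, of T]
    show "((\<lambda>v. iexp (v * X x)) has_vector_derivative \<i> * of_real (X x) * iexp (v * X x)) (at v within T)"
      by simp
  qed
  have bound: "cmod (\<psi>' v + of_real v * \<psi> v) \<le> E" if v: "\<bar>v\<bar> \<le> \<bar>u\<bar>" for v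
  proof -
    define D where "D = (\<Sum>x\<in>A. of_nat (S x) * iexp (v / s * real (S x)))
        - of_real \<mu> * (\<Sum>x\<in>A. iexp (v / s * real (Suc (S x))))"
    \<comment> \<open>Writing \<open>X x = S x / s - s\<close> and inserting the shifted exponential
      splits the summand into the Stein difference and a multiple of \<open>w\<close>. To first
      order \<open>iexp (v / s) - 1\<close> is \<open>\<i> * v / s\<close>, so the leading terms of
      \<open>w\<close> cancel.\<close>
    define w where "w = \<i> * of_real s * (iexp (v / s) - 1) + of_real v"
    have split: "(\<i> * of_real (X x) + of_real v) * iexp (v * X x) =
        \<i> / of_real s * iexp (- (v * s)) * (of_nat (S x) * iexp (v / s * real (S x))
          - of_real \<mu> * iexp (v / s * real (Suc (S x)))) + w * iexp (v * X x)" for x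
    proof -
      have X: "X x = real (S x) / s - s" unfolding X_def s(2)[symmetric] using s(1) by (simp add: field_simps)
      have e1: "iexp (v * X x) = iexp (- (v * s)) * iexp (v / s * real (S x))"
        by (simp add: X exp_add[symmetric] algebra_simps)
      have e2: "iexp (v / s * real (Suc (S x))) = iexp (v / s) * iexp (v / s * real (S x))"
        by (simp add: exp_add[symmetric] algebra_simps add_divide_distrib)
      show ?thesis
      proof -
        have "(\<i> * (m / z - z) + y) * (p * q) =
            \<i> / z * p * (m * q - z * z * (r * q)) + (\<i> * z * (r - 1) + y) * (p * q)"
          if "z \<noteq> 0" for z m y p q r :: complex
          using that by (simp add: field_simps)
        from this[of "of_real s" "of_nat (S x)" "of_real v"] show ?thesis
          unfolding e1 e2 unfolding w_def X s(2)[symmetric] using s(1) by simp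
      qed
    qed
    have "\<psi>' v + of_real v * \<psi> v = (\<Sum>x\<in>A. (\<i> * of_real (X x) + of_real v) * iexp (v * X x)) / of_real N"
      by (simp add: \<psi>_def \<psi>'_def add_divide_distrib[symmetric] sum_distrib_left
          sum.distrib[symmetric] distrib_right)
    also have "\<dots> = \<i> / of_real s * iexp (- (v * s)) * D / of_real N + w * \<psi> v"
      unfolding split D_def \<psi>_def
      by (simp only: sum.distrib sum_subtractf sum_distrib_left[symmetric] add_divide_distrib
          times_divide_eq_right)
    finally have "cmod (\<psi>' v + of_real v * \<psi> v) \<le>
        cmod (\<i> / of_real s * iexp (- (v * s)) * D / of_real N) + cmod (w * \<psi> v)"
      by (metis norm_triangle_ineq)
    also have "cmod (\<i> / of_real s * iexp (- (v * s)) * D / of_real N) = cmod D / N / s"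
      using s N by (simp add: norm_mult norm_divide)
    also have "\<dots> \<le> \<eta> / s"
      using stein[OF v] s N
      by (intro divide_right_mono) (simp_all add: D_def s_def N_def field_simps)
    also have "cmod (w * \<psi> v) \<le> cmod w * 1"
    proof -
      have "cmod (\<Sum>x\<in>A. iexp (v * X x)) \<le> N * 1"
        unfolding N_def by (intro order_trans[OF norm_sum] sum_bounded_above) simp
      then show ?thesis
        unfolding norm_mult using N by (intro mult_left_mono) (simp_all add: \<psi>_def norm_divide)
    qed
    also have "cmod w * 1 = s * cmod (iexp (v / s) - (\<Sum>k\<le>1. (\<i> * of_real (v / s)) ^ k / fact k))"
    proof -
      have "w = \<i> * of_real s * (iexp (v / s) - (\<Sum>k\<le>1. (\<i> * of_real (v / s)) ^ k / fact k))"
        using s by (simp add: w_def algebra_simps)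
      then show ?thesis using s by (simp add: norm_mult)
    qed
    also have "\<dots> \<le> s * (\<bar>v / s\<bar> ^ 2 / 2)"
      using iexp_approx1[of "v / s" 1] s by (intro mult_left_mono) (simp_all add: numeral_2_eq_2)
    also have "\<dots> = v\<^sup>2 / 2 / s" using s(1) by (simp add: power2_eq_square field_simps)
    also have "\<dots> \<le> u\<^sup>2 / 2 / s"
      using v s by (intro divide_right_mono) (auto simp: abs_le_square_iff)
    finally show ?thesis by (simp add: E_def add_divide_distrib)
  qed
  \<comment> \<open>the integrating factor turns the approximate differential equation into a bound on \<open>h'\<close>\<close>
  define h where "h v = \<psi> v * of_real (exp (v\<^sup>2 / 2))" for v
  have h: "(h has_vector_derivative (\<psi>' v + of_real v * \<psi> v) * of_real (exp (v\<^sup>2 / 2))) (at v within T)" for v T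
  proof -
    have "((\<lambda>v. exp (v\<^sup>2 / 2)) has_real_derivative v * exp (v\<^sup>2 / 2)) (at v within T)"
      by (auto intro!: derivative_eq_intros)
    then have "((\<lambda>v. complex_of_real (exp (v\<^sup>2 / 2))) has_vector_derivative
        of_real (v * exp (v\<^sup>2 / 2))) (at v within T)"
      by (intro has_vector_derivative_of_real)
        (simp add: has_real_derivative_iff_has_vector_derivative)
    from has_vector_derivative_mult[OF deriv this] show ?thesis
      unfolding h_def by (simp add: algebra_simps)
  qed
  have E0: "E \<ge> 0" using order_trans[OF norm_ge_zero bound[of u]] by simp
  \<comment> \<open>Mean value inequality on a symmetric interval, which covers both signs of
    \<open>u\<close>. The factor \<open>exp (u^2 / 2)\<close> later cancels against the integrating
    factor at \<open>u\<close>.\<close>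
  have "cmod (h u - h 0) \<le> (E * exp (u\<^sup>2 / 2)) * norm (u - 0)"
  proof (rule differentiable_bound)
    show "convex {- \<bar>u\<bar>..\<bar>u\<bar>}" by simp
    show "(h has_derivative (\<lambda>y. y *\<^sub>R ((\<psi>' v + of_real v * \<psi> v) * of_real (exp (v\<^sup>2 / 2)))))
        (at v within {- \<bar>u\<bar>..\<bar>u\<bar>})" for v
      using h unfolding has_vector_derivative_def .
    show "onorm (\<lambda>y. y *\<^sub>R ((\<psi>' v + of_real v * \<psi> v) * complex_of_real (exp (v\<^sup>2 / 2))))
        \<le> E * exp (u\<^sup>2 / 2)" if "v \<in> {- \<bar>u\<bar>..\<bar>u\<bar>}" for v
    proof (rule onorm_le)
      fix y :: real
      have v: "\<bar>v\<bar> \<le> \<bar>u\<bar>" using that by auto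
      then have "v\<^sup>2 \<le> u\<^sup>2" by (simp add: abs_le_square_iff)
      then have "cmod (\<psi>' v + of_real v * \<psi> v) * exp (v\<^sup>2 / 2) \<le> E * exp (u\<^sup>2 / 2)"
        using bound[OF v] E0 by (intro mult_mono) auto
      then show "cmod (y *\<^sub>R ((\<psi>' v + of_real v * \<psi> v) * complex_of_real (exp (v\<^sup>2 / 2))))
          \<le> E * exp (u\<^sup>2 / 2) * norm y"
        by (simp add: norm_mult mult.commute mult_left_mono)
    qed
  qed auto
  moreover have "h 0 = 1" using A by (simp add: h_def \<psi>_def N_def)
  moreover have "h u - 1 = of_real (exp (u\<^sup>2 / 2)) * (\<psi> u - of_real (exp (- (u\<^sup>2) / 2)))"
    by (simp add: h_def algebra_simps exp_add[symmetric] flip: of_real_mult)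
  ultimately have "exp (u\<^sup>2 / 2) * cmod (\<psi> u - of_real (exp (- (u\<^sup>2) / 2))) \<le> exp (u\<^sup>2 / 2) * (E * \<bar>u\<bar>)"
    by (simp add: norm_mult mult_ac)
  then have "cmod (\<psi> u - of_real (exp (- (u\<^sup>2) / 2))) \<le> \<bar>u\<bar> * E"
    by (simp add: mult.commute)
  then show ?thesis by (simp add: \<psi>_def X_def N_def E_def s_def)
qed

section \<open>Explicit bound for the characteristic function of a coloured pairing\<close>

text \<open>This controls the largest degree by the second moment: the square root of the number of
  monochromatic pairs serves as \<open>K\<close> in the Stein bound.\<close>

lemma card_colour_class_le:
  assumes "finite H" "h \<in> H"
  shows "(card {x \<in> H - {h}. c x = c h})\<^sup>2 \<le> card (mono_pairs c H)"
proof -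
  let ?C = "{x \<in> H - {h}. c x = c h}"
  \<comment> \<open>the diagonal of the square of the class is sent to the pairs starting at \<open>h\<close>\<close>
  let ?f = "\<lambda>(x, y). if x = y then (h, y) else (x, y)"
  have "card (?C \<times> ?C) \<le> card (mono_pairs c H)"
  proof (rule card_inj_on_le)
    show "inj_on ?f (?C \<times> ?C)" by (auto simp: inj_on_def split: if_splits)
    show "?f ` (?C \<times> ?C) \<subseteq> mono_pairs c H" using assms by (auto simp: mono_pairs_def split: if_splits)
  qed (use assms finite_mono_pairs in auto)
  then show ?thesis by (simp add: card_cartesian_product power2_eq_square)
qed

text \<open>The Stein identity is applied to \<open>g k = exp (\<i> v k / sqrt \<mu>)\<close>, whose
  Lipschitz constant is \<open>\<bar>v\<bar> / sqrt \<mu>\<close>. All errors are expressed through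
  \<open>l\<close>, \<mu> and \<open>r\<close>, and they vanish as \<open>l\<close> and \<mu> grow
  and \<open>r\<close> tends to 0.\<close>

lemma norm_char_monochromatic_le:
  fixes u :: real
  assumes H: "finite H" "even (card H)" "card H \<ge> 6" and M: "mono_pairs c H \<noteq> {}"
  defines "l \<equiv> real (card H)"
  defines "\<mu> \<equiv> real (card (mono_pairs c H)) / (2 * l)"
  defines "r \<equiv> \<mu> / l"
  shows "cmod ((\<Sum>P\<in>pairings H. iexp (u * ((real (monochromatic c P) - \<mu>) / sqrt \<mu>)))
      / of_nat (card (pairings H)) - of_real (exp (- (u\<^sup>2) / 2)))
    \<le> \<bar>u\<bar> * (2 * \<bar>u\<bar> * (2 / l + 6 * sqrt (2 * r) + 8 * r) + 2 * sqrt r + u\<^sup>2 / 2 / sqrt \<mu>)"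
proof -
  define m where "m = real (card (mono_pairs c H))"
  define K where "K = sqrt m"
  \<comment> \<open>\<kappa> is the exact mean of the count, while \<mu> is the centring used in the
    theorem; they differ by \<open>\<mu> / (l - 1)\<close>.\<close>
  define \<kappa> where "\<kappa> = m / (2 * (l - 1))"
  define \<epsilon> where "\<epsilon> = (1 + K) / (l - 1) + (l * K + m) / ((l - 1) * (l - 3))"
  \<comment> \<open>The first summand is the Stein error with \<kappa> bounded by
    \<open>2 * \<mu>\<close>; the second pays for replacing \<kappa> by \<mu>.\<close>
  define \<eta> where "\<eta> = 2 * \<mu> * (\<bar>u\<bar> / sqrt \<mu>) * \<epsilon> + 2 * r"
  define N where "N = real (card (pairings H))"
  have l: "l \<ge> 6" using H by (simp add: l_def)
  have m: "m > 0" using M finite_mono_pairs[OF H(1)] by (simp add: m_def card_gt_0_iff)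
  have m_eq: "m = 2 * \<mu> * l" using l by (simp add: \<mu>_def m_def)
  have \<mu>: "\<mu> > 0" using m l by (simp add: \<mu>_def m_def)
  have r: "r > 0" using \<mu> l by (simp add: r_def)
  have \<epsilon>0: "\<epsilon> \<ge> 0" using l m by (simp add: \<epsilon>_def K_def)
  have \<kappa>: "\<kappa> \<ge> 0" "\<kappa> \<le> 2 * \<mu>" "\<bar>\<kappa> - \<mu>\<bar> \<le> 2 * r"
  proof -
    have "\<kappa> = \<mu> + \<mu> / (l - 1)" using m_eq l by (simp add: \<kappa>_def field_simps)
    moreover have "\<mu> / (l - 1) \<le> 2 * r" "0 \<le> \<mu> / (l - 1)" "\<mu> / (l - 1) \<le> \<mu>"
      using l \<mu> by (simp_all add: r_def field_simps)
    ultimately show "\<kappa> \<ge> 0" "\<kappa> \<le> 2 * \<mu>" "\<bar>\<kappa> - \<mu>\<bar> \<le> 2 * r" using \<mu> by linarith+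
  qed
  have deg: "real (card {x \<in> H - {h}. c x = c h}) \<le> K" if "h \<in> H" for h
  proof -
    have "real ((card {x \<in> H - {h}. c x = c h})\<^sup>2) \<le> m"
      unfolding m_def using card_colour_class_le[OF H(1) that] by (rule of_nat_mono)
    then show ?thesis unfolding K_def by (intro real_le_rsqrt) simp
  qed
  have "cmod ((\<Sum>P\<in>pairings H. iexp (u * ((real (monochromatic c P) - \<mu>) / sqrt \<mu>)))
      / of_nat (card (pairings H)) - of_real (exp (- (u\<^sup>2) / 2)))
    \<le> \<bar>u\<bar> * ((\<eta> + u\<^sup>2 / 2) / sqrt \<mu>)"
  proof (rule norm_char_diff_le_of_stein[OF finite_pairings pairings_nonempty \<mu>])
    fix v :: real assume v: "\<bar>v\<bar> \<le> \<bar>u\<bar>"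
    define g where "g k = iexp (v / sqrt \<mu> * real k)" for k :: nat
    define G where "G = (\<Sum>P\<in>pairings H. g (Suc (monochromatic c P)))"
    define F where "F = (\<Sum>P\<in>pairings H. of_nat (monochromatic c P) * g (monochromatic c P))"
    have "cmod (g k - g k') \<le> \<bar>v\<bar> / sqrt \<mu> * \<bar>real k - real k'\<bar>" for k k'
    proof -
      have "\<bar>v / sqrt \<mu> * real k - v / sqrt \<mu> * real k'\<bar> = \<bar>v\<bar> / sqrt \<mu> * \<bar>real k - real k'\<bar>"
        unfolding right_diff_distrib[symmetric] abs_mult abs_divide using \<mu> by simp
      then show ?thesis unfolding g_def by (metis norm_iexp_diff_le)
    qed
    from stein_monochromatic[OF H(1) _ deg this, folded l_def m_def]
    have "cmod (F - of_real \<kappa> * G) \<le> \<kappa> * (\<bar>v\<bar> / sqrt \<mu>) * N * \<epsilon>"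
      using H by (simp add: F_def G_def \<kappa>_def \<epsilon>_def N_def)
    also have "\<dots> \<le> (2 * \<mu>) * (\<bar>u\<bar> / sqrt \<mu>) * N * \<epsilon>"
      using \<kappa> v \<mu> \<epsilon>0 by (intro mult_right_mono mult_mono divide_right_mono) (auto simp: N_def)
    finally have 1: "cmod (F - of_real \<kappa> * G) \<le> (2 * \<mu>) * (\<bar>u\<bar> / sqrt \<mu>) * N * \<epsilon>" .
    have "cmod G \<le> N * 1"
      unfolding G_def N_def g_def by (intro order_trans[OF norm_sum] sum_bounded_above) simp
    then have 2: "cmod (of_real (\<kappa> - \<mu>) * G) \<le> 2 * r * (N * 1)"
      unfolding norm_mult norm_of_real using \<kappa> r by (intro mult_mono) auto
    have "F - of_real \<mu> * G = (F - of_real \<kappa> * G) + of_real (\<kappa> - \<mu>) * G"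
      by (simp add: algebra_simps)
    then have "cmod (F - of_real \<mu> * G) \<le> cmod (F - of_real \<kappa> * G) + cmod (of_real (\<kappa> - \<mu>) * G)"
      by (metis norm_triangle_ineq)
    also have "\<dots> \<le> N * \<eta>" using 1 2 by (simp add: \<eta>_def algebra_simps)
    finally show "cmod ((\<Sum>x\<in>pairings H. of_nat (monochromatic c x) *
          iexp (v / sqrt \<mu> * real (monochromatic c x)))
        - of_real \<mu> * (\<Sum>x\<in>pairings H. iexp (v / sqrt \<mu> * real (Suc (monochromatic c x)))))
        \<le> real (card (pairings H)) * \<eta>"
      by (simp add: F_def G_def g_def N_def)
  qed (use H in auto)
  also have "\<bar>u\<bar> * ((\<eta> + u\<^sup>2 / 2) / sqrt \<mu>) =
      \<bar>u\<bar> * (2 * \<bar>u\<bar> * \<epsilon> + 2 * (r / sqrt \<mu>) + u\<^sup>2 / 2 / sqrt \<mu>)"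
  proof -
    have "2 * \<mu> * (\<bar>u\<bar> / sqrt \<mu>) * \<epsilon> / sqrt \<mu> = 2 * \<bar>u\<bar> * \<epsilon>"
      using \<mu> by (simp add: field_simps)
    then show ?thesis by (simp add: \<eta>_def add_divide_distrib)
  qed
  also have "\<dots> \<le> \<bar>u\<bar> * (2 * \<bar>u\<bar> * (2 / l + 6 * sqrt (2 * r) + 8 * r) + 2 * sqrt r + u\<^sup>2 / 2 / sqrt \<mu>)"
  proof (intro mult_left_mono add_mono)
    \<comment> \<open>Hence \<open>K\<close> is of smaller order than \<open>l\<close> as soon as
      \<open>r\<close> tends to 0.\<close>
    have Kl: "K = l * sqrt (2 * r)"
    proof -
      have "m = l\<^sup>2 * (2 * r)" using l by (simp add: m_eq r_def power2_eq_square)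
      then show ?thesis using l by (simp add: K_def real_sqrt_mult)
    qed
    \<comment> \<open>Here \<open>l \<ge> 6\<close> enters: it gives
      \<open>l - 3 \<ge> l / 2\<close>.\<close>
    have l1: "1 / (l - 1) \<le> 2 / l" "1 / (l - 3) \<le> 2 / l" using l by (simp_all add: field_simps)
    have l13: "1 / (l - 1) * (1 / (l - 3)) \<le> 2 / l * (2 / l)"
      using l l1 by (intro mult_mono) auto
    have "\<epsilon> = (1 + K) * (1 / (l - 1)) + (l * K + m) * (1 / (l - 1) * (1 / (l - 3)))"
      by (simp add: \<epsilon>_def)
    also have "\<dots> \<le> (1 + K) * (2 / l) + (l * K + m) * (2 / l * (2 / l))"
      using l1 l13 l m by (intro add_mono mult_left_mono) (auto simp: K_def)
    also have "\<dots> = 2 / l + 6 * sqrt (2 * r) + 8 * r"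
      using l by (simp add: Kl m_eq r_def field_simps)
    finally show "\<epsilon> \<le> 2 / l + 6 * sqrt (2 * r) + 8 * r" .
    have "r / sqrt \<mu> = sqrt (r / l)"
      using l \<mu> by (simp add: r_def real_sqrt_divide real_div_sqrt field_simps)
    also have "\<dots> \<le> sqrt r" using l r by (simp add: field_simps)
    finally show "r / sqrt \<mu> \<le> sqrt r" .
  qed auto
  finally show ?thesis .
qed

section \<open>Self-loops of the configuration model\<close>

lemma finite_half_edges [simp]: "finite (half_edges n d)"
  by (simp add: half_edges_def)

lemma card_half_edges: "card (half_edges n d) = total_degree n d"
  by (simp add: half_edges_def total_degree_def)

text \<open>With vertices as colours, the \<mu> of the preceding bound thereby becomes half of
  \<open>nu\<close>.\<close>

lemma card_mono_pairs_half_edges: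
  "card (mono_pairs fst (half_edges n d)) = (\<Sum>i\<in>{1..n}. d i * (d i - 1))"
proof -
  have "bij_betw (\<lambda>(i, x, y). ((i, x), (i, y))) (SIGMA i:{1..n}. SIGMA x:{1..d i}. {1..d i} - {x})
      (mono_pairs fst (half_edges n d))"
    by (rule bij_betw_byWitness[where f' = "\<lambda>((i, x), (j, y)). (i, x, y)"])
      (auto simp: mono_pairs_def half_edges_def)
  from bij_betw_same_card[OF this] show ?thesis by simp
qed

text \<open>Parallel loops arise from different edges of \<open>P\<close>, and the image multiset
  keeps their multiplicity. The multiset \<open>{#i, i#}\<close> determines \<open>i\<close>, so
  loops at different vertices come from disjoint sets of edges.\<close>

lemma self_loops_multigraph_of_pairing:
  assumes P: "P \<in> pairings (half_edges n d)"
  shows "self_loops n (multigraph_of_pairing P) = monochromatic fst P"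
proof -
  have fin: "finite P" using finite_pairing[OF P] by simp
  let ?f = "\<lambda>e. image_mset fst (mset_set e)"
  have "self_loops_at (multigraph_of_pairing P) i = card {e \<in> P. ?f e = {#i, i#}}" for i
    using fin by (simp add: self_loops_at_def multigraph_of_pairing_def count_image_mset'
        card_eq_sum eq_commute[of "{#i, i#}"] flip: card_eq_sum cong: conj_cong)
  then have "self_loops n (multigraph_of_pairing P) = (\<Sum>i\<in>{1..n}. card {e \<in> P. ?f e = {#i, i#}})"
    by (simp add: self_loops_def)
  also have "\<dots> = card (\<Union>i\<in>{1..n}. {e \<in> P. ?f e = {#i, i#}})"
    using fin by (intro card_UN_disjoint[symmetric]) (auto dest: arg_cong[where f = set_mset])
  also have "(\<Union>i\<in>{1..n}. {e \<in> P. ?f e = {#i, i#}}) = {e \<in> P. is_singleton (fst ` e)}"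
  proof -
    have "(\<exists>i\<in>{1..n}. ?f e = {#i, i#}) \<longleftrightarrow> is_singleton (fst ` e)" if e: "e \<in> P" for e
    proof -
      from pairing_edge[OF P e] obtain a b
        where ab: "e = {a, b}" "a \<noteq> b" "a \<in> half_edges n d" "b \<in> half_edges n d" .
      then have "?f e = {#fst a, fst b#}" by simp
      moreover have "fst a \<in> {1..n}" using ab by (auto simp: half_edges_def)
      ultimately have "(\<exists>i\<in>{1..n}. ?f e = {#i, i#}) \<longleftrightarrow> fst a = fst b"
        by (auto simp: add_eq_conv_ex)
      then show ?thesis unfolding ab(1) is_singleton_image_doubleton .
    qed
    then show ?thesis by auto
  qed
  finally show ?thesis by (simp add: monochromatic_def)
qed

lemma char_configuration_model:
  assumes "even (total_degree n d)"
  shows "char (distr (configuration_model n d) borel (\<lambda>G. f (self_loops n G))) t =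
    (\<Sum>P\<in>pairings (half_edges n d). iexp (t * f (monochromatic fst P)))
      / of_nat (card (pairings (half_edges n d)))"
proof -
  let ?A = "pairings (half_edges n d)"
  have A: "finite ?A" "?A \<noteq> {}"
    using assms pairings_nonempty[of "half_edges n d"]
    by (auto intro: finite_pairings simp: card_half_edges)
  have "char (distr (configuration_model n d) borel (\<lambda>G. f (self_loops n G))) t =
      (LINT G|configuration_model n d. iexp (t * f (self_loops n G)))"
    unfolding char_def by (subst integral_distr) auto
  also have "\<dots> = (LINT P|pmf_of_set ?A. iexp (t * f (self_loops n (multigraph_of_pairing P))))"
    by (simp add: configuration_model_def)
  also have "\<dots> = (\<Sum>P\<in>?A. iexp (t * f (self_loops n (multigraph_of_pairing P))) / of_nat (card ?A))"
    using A by (subst integral_measure_pmf[of ?A]) (auto simp: scaleR_conv_of_real divide_simps)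
  finally show ?thesis
    by (simp add: sum_divide_distrib self_loops_multigraph_of_pairing)
qed

section \<open>Passage to the limit\<close>

lemma powr_div_self_tendsto_0:
  fixes a :: real
  assumes "a < 1"
  shows "(\<lambda>n. real n powr a / real n) \<longlonglongrightarrow> 0"
proof -
  have "(\<lambda>n. real n powr (a - 1)) \<longlonglongrightarrow> 0"
    using assms by (intro tendsto_neg_powr filterlim_real_sequentially) auto
  moreover have "eventually (\<lambda>n. real n powr (a - 1) = real n powr a / real n) sequentially"
    using eventually_gt_at_top[of 0] by eventually_elim (simp add: powr_diff)
  ultimately show ?thesis by (rule Lim_transform_eventually)
qed

text \<open>The three limits assumed here are exactly what sends the bound of
  \<open>norm_char_monochromatic_le\<close> to 0 for each fixed \<open>u\<close>; Levy's continuity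
  theorem then gives convergence in law.\<close>

lemma self_loops_clt:
  fixes d :: "nat \<Rightarrow> nat \<Rightarrow> nat"
  assumes even: "\<And>n. n \<ge> 1 \<Longrightarrow> even (total_degree n (d n))"
    and total: "filterlim (\<lambda>n. total_degree n (d n)) at_top sequentially"
    and nu: "filterlim (\<lambda>n. nu n (d n)) at_top sequentially"
    and ratio: "(\<lambda>n. nu n (d n) / real (total_degree n (d n))) \<longlonglongrightarrow> 0"
  shows "weak_conv_m
           (\<lambda>n. distr (configuration_model n (d n)) borel
             (\<lambda>G. (real (self_loops n G) - nu n (d n) / 2) / sqrt (nu n (d n) / 2)))
           std_normal_distribution"
proof (rule levy_continuity)
  fix n
  show "real_distribution (distr (configuration_model n (d n)) borel
      (\<lambda>G. (real (self_loops n G) - nu n (d n) / 2) / sqrt (nu n (d n) / 2)))"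
    by (intro prob_space.real_distribution_distr prob_space_measure_pmf) simp
next
  show "real_distribution std_normal_distribution" by (rule real_dist_normal_dist)
next
  fix u :: real
  define l where "l n = real (total_degree n (d n))" for n
  define \<mu> where "\<mu> n = nu n (d n) / 2" for n
  define \<psi> where "\<psi> n = char (distr (configuration_model n (d n)) borel
      (\<lambda>G. (real (self_loops n G) - \<mu> n) / sqrt (\<mu> n))) u" for n
  define b where "b n = \<bar>u\<bar> * (2 * \<bar>u\<bar> * (2 / l n + 6 * sqrt (2 * (\<mu> n / l n)) + 8 * (\<mu> n / l n))
      + 2 * sqrt (\<mu> n / l n) + u\<^sup>2 / 2 / sqrt (\<mu> n))" for n
  have l: "filterlim l at_top sequentially"
    unfolding l_def by (rule filterlim_compose[OF filterlim_real_sequentially total])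
  have \<mu>: "filterlim \<mu> at_top sequentially"
    unfolding \<mu>_def using filterlim_tendsto_pos_mult_at_top[OF tendsto_const[of "1/2 :: real"] _ nu] by simp
  have r: "(\<lambda>n. \<mu> n / l n) \<longlonglongrightarrow> 0"
    using tendsto_mult[OF tendsto_const[of "1/2 :: real"] ratio] by (simp add: \<mu>_def l_def)
  have "filterlim (\<lambda>n. sqrt (\<mu> n)) at_top sequentially"
    by (rule filterlim_compose[OF sqrt_at_top \<mu>])
  then have "b \<longlonglongrightarrow> \<bar>u\<bar> * (2 * \<bar>u\<bar> * (0 + 6 * sqrt (2 * 0) + 8 * 0) + 2 * sqrt 0 + 0)"
    unfolding b_def using l r
    by (intro tendsto_intros real_tendsto_divide_at_top[OF tendsto_const]) auto
  then have b: "b \<longlonglongrightarrow> 0" by simp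
  have "eventually (\<lambda>n. cmod (\<psi> n - of_real (exp (- (u\<^sup>2) / 2))) \<le> b n) sequentially"
    using eventually_ge_at_top[of 1] filterlim_at_top_dense[THEN iffD1, OF nu, rule_format, of 0]
      total[unfolded filterlim_at_top, rule_format, of 6]
  proof eventually_elim
    case (elim n)
    let ?H = "half_edges n (d n)"
    have H: "finite ?H" "even (card ?H)" "card ?H \<ge> 6"
      using elim even by (simp_all add: card_half_edges)
    have l_eq: "real (card ?H) = l n" by (simp add: l_def card_half_edges)
    \<comment> \<open>Truncated subtraction agrees with the real one here, since at degree 0 the
      other factor vanishes.\<close>
    have "real (card (mono_pairs fst ?H)) = (\<Sum>i\<in>{1..n}. real (d n i) * (real (d n i) - 1))"
      unfolding card_mono_pairs_half_edges of_nat_sum of_nat_mult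
      by (intro sum.cong refl) (auto simp: of_nat_diff)
    then have \<mu>_eq: "real (card (mono_pairs fst ?H)) / (2 * real (card ?H)) = \<mu> n"
      by (simp add: \<mu>_def nu_def card_half_edges)
    have "\<mu> n > 0" using elim by (simp add: \<mu>_def)
    then have "mono_pairs fst ?H \<noteq> {}" using \<mu>_eq by auto
    from norm_char_monochromatic_le[OF H this, of u, unfolded \<mu>_eq, unfolded l_eq]
    show ?case
      unfolding \<psi>_def b_def char_configuration_model[OF even[OF elim(1)],
          where f = "\<lambda>k. (real k - \<mu> n) / sqrt (\<mu> n)"] .
  qed
  then have "(\<lambda>n. \<psi> n - of_real (exp (- (u\<^sup>2) / 2))) \<longlonglongrightarrow> 0"
    by (rule Lim_null_comparison[OF _ b])
  then show "(\<lambda>n. char (distr (configuration_model n (d n)) borel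
      (\<lambda>G. (real (self_loops n G) - nu n (d n) / 2) / sqrt (nu n (d n) / 2))) u)
      \<longlonglongrightarrow> char std_normal_distribution u"
    unfolding char_std_normal_distribution \<psi>_def \<mu>_def by (rule LIM_zero_cancel)
qed

theorem theorem1p7:
  fixes \<tau> :: real
    and d :: "nat \<Rightarrow> nat \<Rightarrow> nat"
    and M :: "'a measure"
    and D :: "'a \<Rightarrow> real"
  assumes "\<tau> > 2"
    and "\<And>n i. n \<ge> 1 \<Longrightarrow> i \<in> {1..n} \<Longrightarrow> d n i > 0"
    and "\<And>n. n \<ge> 1 \<Longrightarrow> even (total_degree n (d n))"
    and "prob_space M"
    and "D \<in> borel_measurable M"
    and "weak_conv_m (\<lambda>n. distr (degree_pmf n (d n)) borel real) (distr M borel D)"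
    and "integrable M D"
    and "(\<lambda>n. measure_pmf.expectation (degree_pmf n (d n)) real)
           \<longlonglongrightarrow> integral\<^sup>L M D"
    and "filterlim (\<lambda>n. nu n (d n)) at_top sequentially"
    and "(\<lambda>n. nu n (d n)) \<in> \<Theta>(\<lambda>n. real n powr (2 / (\<tau> - 1) - 1))"
  shows "weak_conv_m
           (\<lambda>n. distr (configuration_model n (d n)) borel
             (\<lambda>G. (real (self_loops n G) - nu n (d n) / 2) / sqrt (nu n (d n) / 2)))
           std_normal_distribution"
proof (rule self_loops_clt[OF assms(3) _ assms(9)])
  have total_ge: "total_degree n (d n) \<ge> n" if "n \<ge> 1" for n
  proof -
    have "(\<Sum>i\<in>{1..n}. 1) \<le> total_degree n (d n)"
      unfolding total_degree_def using assms(2)[OF that] by (intro sum_mono) (simp add: Suc_le_eq)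
    then show ?thesis by simp
  qed
  then show "filterlim (\<lambda>n. total_degree n (d n)) at_top sequentially"
    by (intro filterlim_at_top_mono[OF filterlim_ident] eventually_sequentiallyI[of 1]) auto
  \<comment> \<open>The upper half of the order estimate, divided by a total degree of at least
    \<open>n\<close>, bounds the ratio by a power of \<open>n\<close> with negative
    exponent.\<close>
  from assms(10) obtain C where
    C: "eventually (\<lambda>n. norm (nu n (d n)) \<le> C * norm (real n powr (2 / (\<tau> - 1) - 1))) sequentially"
    by (blast elim: landau_o.bigE dest: bigthetaD1)
  show "(\<lambda>n. nu n (d n) / real (total_degree n (d n))) \<longlonglongrightarrow> 0"
  proof (rule Lim_null_comparison)
    show "eventually (\<lambda>n. norm (nu n (d n) / real (total_degree n (d n)))
        \<le> C * (real n powr (2 / (\<tau> - 1) - 1) / real n)) sequentially"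
      using C eventually_ge_at_top[of 1]
    proof eventually_elim
      case (elim n)
      have "norm (nu n (d n) / real (total_degree n (d n))) \<le> norm (nu n (d n)) / real n"
        using total_ge[OF elim(2)] elim(2) by (auto intro!: divide_left_mono)
      also have "\<dots> \<le> C * real n powr (2 / (\<tau> - 1) - 1) / real n"
        using elim by (intro divide_right_mono) auto
      finally show ?case by simp
    qed
    show "(\<lambda>n. C * (real n powr (2 / (\<tau> - 1) - 1) / real n)) \<longlonglongrightarrow> 0"
    proof -
      \<comment> \<open>This is where \<open>\<tau> > 2\<close> enters: it is equivalent to
        \<open>\<tau> - 1 > 1\<close>.\<close>
      have "2 / (\<tau> - 1) - 1 < 1" using assms(1) by (simp add: field_simps)
      from tendsto_mult[OF tendsto_const powr_div_self_tendsto_0[OF this], of C] show ?thesis by simp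
    qed
  qed
qed

end
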